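(* Let $r\in\mathbb{N}$, $a\in\mathbb{R}$, let $\alpha_0,\ldots,\alpha_{r-1}$ be fixed real numbers, and consider the problem $$\int_a^{+\infty}L\left(t,x(t),x'(t),\ldots,x^{(r)}(t)\right)dt\longrightarrow\max,\qquad x\in C^r([a,+\infty[,\mathbb{R}),\qquad x(a)=\alpha_0,\ \ldots,\ x^{(r-1)}(a)=\alpha_{r-1},$$ where $(u_0,\ldots,u_r)\mapsto L(t,u_0,\ldots,u_r)$ is a $C^1(\mathbb{R}^{r+1},\mathbb{R})$ function for any $t\in[a,+\infty[$, and $\partial_{i+2}L\in C^r([a,+\infty[,\mathbb{R})$ for all $i=1,\ldots,r$ and all $x\in C^r([a,+\infty[,\mathbb{R})$ (that is, $t\mapsto\partial_{i+2}L(t,x(t),\ldots,x^{(r)}(t))$ is $C^r$). Suppose that a maximizer (in the weakly maximal sense) to this problem exists and is given by $x_\ast$. For $\eta\in C^r([a,+\infty[,\mathbb{R})$ with $\eta(a)=0,\ldots,\eta^{(r-1)}(a)=0$, define $$A(\varepsilon,T'):=\int_a^{T'}\frac{L\left(t,x_\ast(t)+\varepsilon\eta(t),\ldots,x_\ast^{(r)}(t)+\varepsilon\eta^{(r)}(t)\right)-L\left(t,x_\ast(t),\ldots,x_\ast^{(r)}(t)\right)}{\varepsilon}\,dt,$$ $$V(\varepsilon,T):=\inf_{T'\ge T}\int_a^{T'}\left[L\left(t,x_\ast(t)+\varepsilon\eta(t),\ldots,x_\ast^{(r)}(t)+\varepsilon\eta^{(r)}(t)\right)-L\left(t,x_\ast(t),\ldots,x_\ast^{(r)}(t)\right)\right]dt,$$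 $$V(\varepsilon):=\lim_{T\to+\infty}V(\varepsilon,T).$$ Suppose that for every such $\eta$: 1. $\lim_{\varepsilon\to0}\frac{V(\varepsilon,T)}{\varepsilon}$ exists for all $T$; 2. $\lim_{T\to+\infty}\frac{V(\varepsilon,T)}{\varepsilon}$ exists uniformly for $\varepsilon$; 3. for every $T>a$ there exists a sequence $(T'_n)_{n\in\mathbb{N}}$ of real numbers with $T'_n\ge T$ such that $\lim_{n\to+\infty}A(\varepsilon,T'_n)=\inf_{T'\ge T}A(\varepsilon,T')$ uniformly for $\varepsilon\in\mathbb{R}\setminus\{0\}$. Then $x=x_\ast$ satisfies the Euler--Lagrange equation $$\sum_{i=0}^r(-1)^i\left(\partial_{i+2}L\right)^{(i)}\left(t,x(t),x'(t),\ldots,x^{(r)}(t)\right)=0\qquad\text{for all }t\in[a,+\infty[,$$ and, for each $k=1,\ldots,r$, the transversality condition $$\lim_{T\to+\infty}\inf_{T'\ge T}\left\{\left(\partial_{r+2-(k-1)}L\left(T',x(T'),\ldots,x^{(r)}(T')\right)+\sum_{i=1}^{k-1}(-1)^i\left(\partial_{r+2-(k-1)+i}L\right)^{(i)}\left(T',x(T'),\ldots,x^{(r)}(T')\right)\right)x^{(r-k)}(T')\right\}=0.$$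
   Context: $\partial_iL$ is the partial derivative of $L(t,u_0,\ldots,u_r)$ with respect to its $i$th argument ($t$ is the first). $(\partial_{i+2}L)^{(i)}(t,x(t),\ldots,x^{(r)}(t))$ denotes the $i$th derivative at $t$ of the function $s\mapsto\partial_{i+2}L(s,x(s),\ldots,x^{(r)}(s))$. $T,T'$ are real numbers with $T'\ge T>a$. Sums $\sum_{i=1}^{0}$ are $0$. Admissible functions are $x\in C^r([a,+\infty[,\mathbb{R})$ with $x^{(i)}(a)=\alpha_i$ for $i=0,\ldots,r-1$. A function $x_\ast$ is weakly maximal (a maximizer) if it is admissible and $$\lim_{T\to+\infty}\inf_{T'\ge T}\int_a^{T'}\left[L\left(t,x(t),\ldots,x^{(r)}(t)\right)-L\left(t,x_\ast(t),\ldots,x_\ast^{(r)}(t)\right)\right]dt\le0$$ for every admissible $x$.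
   Formalization: Added assumption: t ↦ ∂₂L(t,x(t),…,x^{(r)}(t)) is continuous on [a,+∞[ for every x in C^r; without it the claim fails (r=1, L=u₀ at the single time t=1 and 0 otherwise). *)

theory Defs
  imports "HOL-Analysis.Analysis"
begin

(* Derivatives on the half-line [a, oo): they are one-sided at a, so the values of a
   function to the left of a are irrelevant. *)
primrec nderiv :: "real \<Rightarrow> nat \<Rightarrow> (real \<Rightarrow> real) \<Rightarrow> real \<Rightarrow> real" where
  "nderiv a 0 f = f"
| "nderiv a (Suc n) f = (\<lambda>t. vector_derivative (nderiv a n f) (at t within {a..}))"

definition Ck :: "nat \<Rightarrow> real \<Rightarrow> (real \<Rightarrow> real) set" where
  "Ck k a = {f. (\<forall>i<k. \<forall>t\<ge>a. nderiv a i f differentiable (at t within {a..}))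
               \<and> continuous_on {a..} (nderiv a k f)}"

(* A point (u_0, ..., u_r) of R^(r+1) is a function in extensional {..r}; the topology of
   nat => real is the product topology, which induces the Euclidean one on this subspace. *)
definition C1 :: "nat \<Rightarrow> ((nat \<Rightarrow> real) \<Rightarrow> real) \<Rightarrow> bool" where
  "C1 r f \<longleftrightarrow> (\<forall>i\<le>r.
     (\<forall>u\<in>extensional {..r}. (\<lambda>s. f (u(i := s))) field_differentiable (at (u i))) \<and>
     continuous_on (extensional {..r}) (\<lambda>u. deriv (\<lambda>s. f (u(i := s))) (u i)))"

(* Partial derivative of L(t, u_0, ..., u_r) in its j-th argument, j >= 2. As t is the first
   argument, the j-th one is u_(j-2). *)
definition argderiv ::
    "(real \<Rightarrow> (nat \<Rightarrow> real) \<Rightarrow> real) \<Rightarrow> nat \<Rightarrow> real \<Rightarrow> (nat \<Rightarrow> real) \<Rightarrow> real" where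
  "argderiv L j t u = deriv (\<lambda>s. L t (u(j - 2 := s))) (u (j - 2))"

definition jet :: "nat \<Rightarrow> real \<Rightarrow> (real \<Rightarrow> real) \<Rightarrow> real \<Rightarrow> nat \<Rightarrow> real" where
  "jet r a x t = (\<lambda>i\<in>{..r}. nderiv a i x t)"

definition perturbed_jet ::
    "nat \<Rightarrow> real \<Rightarrow> (real \<Rightarrow> real) \<Rightarrow> (real \<Rightarrow> real) \<Rightarrow> real \<Rightarrow> real \<Rightarrow> nat \<Rightarrow> real" where
  "perturbed_jet r a x \<eta> \<epsilon> t = (\<lambda>i\<in>{..r}. nderiv a i x t + \<epsilon> * nderiv a i \<eta> t)"

definition admissible :: "nat \<Rightarrow> real \<Rightarrow> (nat \<Rightarrow> real) \<Rightarrow> (real \<Rightarrow> real) \<Rightarrow> bool" where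
  "admissible r a \<alpha> x \<longleftrightarrow> x \<in> Ck r a \<and> (\<forall>i<r. nderiv a i x a = \<alpha> i)"

(* Infima over T' >= T are taken in the extended reals, since they may be -oo. *)
definition weakly_maximal ::
    "(real \<Rightarrow> (nat \<Rightarrow> real) \<Rightarrow> real) \<Rightarrow> nat \<Rightarrow> real \<Rightarrow> (nat \<Rightarrow> real) \<Rightarrow> (real \<Rightarrow> real) \<Rightarrow> bool" where
  "weakly_maximal L r a \<alpha> xstar \<longleftrightarrow> admissible r a \<alpha> xstar \<and>
     (\<forall>x. admissible r a \<alpha> x \<longrightarrow>
        (\<exists>l\<le>0. ((\<lambda>T. INF T'\<in>{T..}.
            ereal (integral {a..T'} (\<lambda>t. L t (jet r a x t) - L t (jet r a xstar t)))) \<longlongrightarrow> l) at_top))"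

definition A ::
    "(real \<Rightarrow> (nat \<Rightarrow> real) \<Rightarrow> real) \<Rightarrow> nat \<Rightarrow> real \<Rightarrow> (real \<Rightarrow> real) \<Rightarrow> (real \<Rightarrow> real) \<Rightarrow> real \<Rightarrow> real \<Rightarrow> real" where
  "A L r a xstar \<eta> \<epsilon> T' =
     integral {a..T'} (\<lambda>t. (L t (perturbed_jet r a xstar \<eta> \<epsilon> t) - L t (jet r a xstar t)) / \<epsilon>)"

definition V ::
    "(real \<Rightarrow> (nat \<Rightarrow> real) \<Rightarrow> real) \<Rightarrow> nat \<Rightarrow> real \<Rightarrow> (real \<Rightarrow> real) \<Rightarrow> (real \<Rightarrow> real) \<Rightarrow> real \<Rightarrow> real \<Rightarrow> ereal" where
  "V L r a xstar \<eta> \<epsilon> T = (INF T'\<in>{T..}.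
     ereal (integral {a..T'} (\<lambda>t. L t (perturbed_jet r a xstar \<eta> \<epsilon> t) - L t (jet r a xstar t))))"

(* uniform_limit for extended-real-valued functions. In ereal, \<bar>y - z\<bar> = oo as soon as y or z
   is infinite (even if y = z), so the condition forces the limit to be finite, and
   f n x to be finite for F-almost all n. *)
definition uniform_limit_ereal ::
    "'b set \<Rightarrow> ('a \<Rightarrow> 'b \<Rightarrow> ereal) \<Rightarrow> ('b \<Rightarrow> ereal) \<Rightarrow> 'a filter \<Rightarrow> bool" where
  "uniform_limit_ereal S f l F \<longleftrightarrow>
     (\<forall>e>0. \<forall>\<^sub>F n in F. \<forall>x\<in>S. \<bar>f n x - l x\<bar> < ereal e)"

end

(* The hypotheses force every partial derivative of L to vanish along the maximizer x, which makes
   both conclusions immediate. Maximality and the monotonicity of V in T give V(eps, T) <= 0 for both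
   signs of eps, so the limit of V(eps, T) / eps in hypothesis 1 can only be 0. As V(eps, T) / eps
   bounds A(eps, T) from below for eps > 0 and from above for eps < 0, any limit of A(eps, T) as
   eps -> 0 is 0 as well; when differentiation under the integral is allowed, this limit is the first
   variation over [a, T], which therefore vanishes for every T.

   L is only controlled along curves, so the integrals need not exist for every eta. By Baire's
   theorem, each interval contains a subinterval over which the partial derivatives of L are
   uniformly bounded near the jet of x. For a bump eta supported there, dominated convergence
   applies, and letting T vary shows that the integrand of the first variation vanishes. Bumps with
   prescribed order of vanishing at a point isolate the individual partial derivatives, which are
   thus 0 on a dense set, hence everywhere by continuity. *)
theory Submission
  imports Defs
begin

section \<open>Iterated derivatives on a half-line\<close>

text \<open>Iterated derivatives are identified by exhibiting a chain \<open>F 0, F 1, ...\<close>;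
  the induction rests on uniqueness of one-sided derivatives.\<close>

lemma nderiv_unique:
  assumes f: "\<And>t. t \<ge> a \<Longrightarrow> f t = F 0 t"
    and F: "\<And>i t. i < k \<Longrightarrow> t \<ge> a \<Longrightarrow> (F i has_vector_derivative F (Suc i) t) (at t within {a..})"
  shows "i \<le> k \<Longrightarrow> t \<ge> a \<Longrightarrow> nderiv a i f t = F i t"
proof (induction i arbitrary: t)
  case 0
  then show ?case by (simp add: f)
next
  case (Suc i)
  have "(nderiv a i f has_vector_derivative F (Suc i) t) (at t within {a..})"
    using Suc by (intro has_vector_derivative_transform[OF _ _ F]) auto
  \<comment> \<open>Uniqueness needs a nontrivial filter; the points to the right of
    \<open>t\<close> provide one, also at the endpoint \<open>t = a\<close>.\<close>
  moreover have "at t within {a..} \<noteq> bot"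
  proof
    assume "at t within {a..} = bot"
    moreover have "{t<..} \<subseteq> {a..}" using Suc.prems by auto
    ultimately have "at_right t \<le> bot" using at_le by metis
    then show False by (simp add: bot_unique)
  qed
  ultimately show ?case by (simp add: vector_derivative_within)
qed

lemma CkI:
  assumes f: "\<And>t. t \<ge> a \<Longrightarrow> f t = F 0 t"
    and F: "\<And>i t. i < k \<Longrightarrow> t \<ge> a \<Longrightarrow> (F i has_vector_derivative F (Suc i) t) (at t within {a..})"
    and cont: "continuous_on {a..} (F k)"
  shows "f \<in> Ck k a"
proof -
  note eq = nderiv_unique[of a f F k, OF f F]
  have "nderiv a i f differentiable (at t within {a..})" if "i < k" "t \<ge> a" for i t
  proof -
    have "(nderiv a i f has_vector_derivative F (Suc i) t) (at t within {a..})"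
      using that by (intro has_vector_derivative_transform[OF _ _ F]) (auto simp: eq)
    then show ?thesis by (auto simp: differentiable_def has_vector_derivative_def)
  qed
  moreover have "continuous_on {a..} (nderiv a k f)"
    using cont by (rule continuous_on_eq) (simp add: eq)
  ultimately show ?thesis by (simp add: Ck_def)
qed

lemma nderiv_has_vector_derivative:
  assumes "x \<in> Ck k a" "i < k" "t \<ge> a"
  shows "(nderiv a i x has_vector_derivative nderiv a (Suc i) x t) (at t within {a..})"
  using assms by (simp add: Ck_def vector_derivative_works)

lemma continuous_on_nderiv:
  assumes "x \<in> Ck k a" "i \<le> k"
  shows "continuous_on {a..} (nderiv a i x)"
proof (cases "i = k")
  case False
  then show ?thesis using assms nderiv_has_vector_derivative[of x k a i]
    by (intro continuous_on_vector_derivative[where f' = "nderiv a (Suc i) x"]) auto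
qed (use assms in \<open>auto simp: Ck_def\<close>)

lemma
  assumes "x \<in> Ck k a" "y \<in> Ck k a"
  shows Ck_add_scaled: "(\<lambda>t. x t + c * y t) \<in> Ck k a"
    and nderiv_add_scaled: "\<And>i t. i \<le> k \<Longrightarrow> t \<ge> a \<Longrightarrow>
          nderiv a i (\<lambda>t. x t + c * y t) t = nderiv a i x t + c * nderiv a i y t"
proof -
  define F where "F i t = nderiv a i x t + c * nderiv a i y t" for i t
  have F: "(F i has_vector_derivative F (Suc i) t) (at t within {a..})" if "i < k" "t \<ge> a" for i t
    unfolding F_def using that assms
    by (intro has_vector_derivative_add has_vector_derivative_mult_right nderiv_has_vector_derivative)
  show "(\<lambda>t. x t + c * y t) \<in> Ck k a"
  proof (rule CkI[where F = F])
    show "continuous_on {a..} (F k)"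
      unfolding F_def[abs_def] using assms by (intro continuous_intros continuous_on_nderiv) auto
  qed (auto simp: F_def[of 0] F)
  show "nderiv a i (\<lambda>t. x t + c * y t) t = nderiv a i x t + c * nderiv a i y t"
    if "i \<le> k" "t \<ge> a" for i t
    using nderiv_unique[where F = F and k = k, OF _ F that, where f = "\<lambda>t. x t + c * y t"]
    by (simp add: F_def)
qed

lemma nderiv_zero:
  assumes "\<And>t. t \<ge> a \<Longrightarrow> f t = 0" "t \<ge> a"
  shows "nderiv a i f t = 0"
  using assms by (intro nderiv_unique[where F = "\<lambda>_ _. 0" and k = i]) auto

section \<open>Polynomial bump functions\<close>

text \<open>Differentiation lowers the order of a root by exactly one, so the derivatives vanish at
  \<open>x\<close> until the order is used up.\<close>

lemma poly_pderiv_funpow_eq_0_iff: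
  fixes p :: "real poly"
  assumes "p \<noteq> 0" "k \<le> order x p"
  shows "poly ((pderiv ^^ k) p) x = 0 \<longleftrightarrow> k < order x p"
  using assms
proof (induction k arbitrary: p)
  case 0
  then show ?case by (simp add: order_root)
next
  case (Suc k)
  then have root: "poly p x = 0" by (auto simp: order_root)
  have "pderiv p \<noteq> 0"
  proof
    assume "pderiv p = 0"
    then obtain h where "p = [:h:]" using pderiv_iszero by blast
    with root Suc.prems show False by simp
  qed
  with Suc root order_pderiv[of p x] show ?case
    by (simp add: funpow_Suc_right del: funpow.simps)
qed

text \<open>Roots of order above \<open>k\<close> at \<open>c\<close> and \<open>d\<close> kill all
  derivatives up to order \<open>k\<close> there, so the polynomial and the zero function fit
  together to order \<open>k\<close>.\<close>

lemma
  fixes P :: "real poly"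
  assumes cd: "a < c" "c < d" and P: "P \<noteq> 0" "k < order c P" "k < order d P"
  defines "b \<equiv> \<lambda>t. if t \<in> {c..d} then poly P t else 0"
  shows Ck_poly_bump: "b \<in> Ck k a"
    and nderiv_poly_bump: "\<And>i t. i \<le> k \<Longrightarrow> t \<ge> a \<Longrightarrow>
          nderiv a i b t = (if t \<in> {c..d} then poly ((pderiv ^^ i) P) t else 0)"
proof -
  define F where "F i t = (if t \<in> {c..d} then poly ((pderiv ^^ i) P) t else 0)" for i t
  have zero: "poly ((pderiv ^^ i) P) c = 0" "poly ((pderiv ^^ i) P) d = 0" if "i \<le> k" for i
    using P that by (auto simp: poly_pderiv_funpow_eq_0_iff)
  have clo: "closure (- {c..d}) = {..c} \<union> {d..}"
  proof -
    have "- {c..d} = {..<c} \<union> {d<..}" by auto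
    then show ?thesis by (simp add: closure_lessThan closure_greaterThan)
  qed
  have F: "(F i has_vector_derivative F (Suc i) t) (at t within {a..})" if "i < k" for i t
  proof -
    have "(F i has_vector_derivative F (Suc i) t) (at t within UNIV)"
      unfolding F_def
    proof (rule has_vector_derivative_If_within_closures)
      show "(poly ((pderiv ^^ i) P) has_vector_derivative poly ((pderiv ^^ Suc i) P) t)
              (at t within {c..d} \<union> (closure {c..d} \<inter> closure (- {c..d})))"
        using poly_DERIV[of "(pderiv ^^ i) P" t]
        by (auto simp: has_real_derivative_iff_has_vector_derivative intro: has_vector_derivative_at_within)
    qed (use that zero[of i] zero[of "Suc i"] cd in \<open>auto simp: clo simp del: funpow.simps\<close>)
    then show ?thesis by (auto intro: has_vector_derivative_at_within)
  qed
  have "continuous_on ({c..d} \<union> closure (- {c..d})) (F k)"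
    unfolding F_def using zero[of k] cd
    by (intro continuous_on_cases) (auto simp: clo intro!: continuous_intros)
  moreover have "{c..d} \<union> closure (- {c..d}) = UNIV" by (auto simp: clo)
  ultimately have "continuous_on {a..} (F k)" by (auto intro: continuous_on_subset)
  then show "b \<in> Ck k a" by (intro CkI[where F = F] F) (auto simp: b_def F_def)
  show "nderiv a i b t = (if t \<in> {c..d} then poly ((pderiv ^^ i) P) t else 0)" if "i \<le> k" "t \<ge> a" for i t
    using nderiv_unique[of a b F k i t] F that by (simp add: F_def b_def)
qed

section \<open>The chain rule for functions with continuous partial derivatives\<close>

lemma tendsto_coordinatewise:
  fixes w :: "'a \<Rightarrow> 'i \<Rightarrow> 'b::topological_space"
  assumes "\<And>i. ((\<lambda>n. w n i) \<longlongrightarrow> u i) F"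
  shows "(w \<longlongrightarrow> u) F"
proof -
  have "limitin (product_topology (\<lambda>i::'i. euclidean :: 'b topology) UNIV) w u F"
    using assms by (simp add: limitin_componentwise)
  then show ?thesis by (simp add: euclidean_product_topology)
qed

text \<open>The increments in the chain rule have unknown sign, hence a mean value theorem for
  endpoints in either order.\<close>

lemma MVT_unordered:
  fixes g :: "real \<Rightarrow> real"
  assumes "\<And>x. (g has_real_derivative g' x) (at x)"
  shows "\<exists>\<xi>. \<bar>\<xi> - p\<bar> \<le> \<bar>q - p\<bar> \<and> g q - g p = (q - p) * g' \<xi>"
proof -
  consider "p < q" | "q < p" | "p = q" by linarith
  then show ?thesis
  proof cases
    case 1
    then obtain z where "p < z" "z < q" "g q - g p = (q - p) * g' z"
      using MVT2[of p q g g'] assms by blast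
    then show ?thesis by (intro exI[of _ z]) auto
  next
    case 2
    then obtain z where "q < z" "z < p" "g p - g q = (p - q) * g' z"
      using MVT2[of q p g g'] assms by blast
    then show ?thesis by (intro exI[of _ z]) (auto simp: algebra_simps)
  qed auto
qed

text \<open>\<open>C1\<close> speaks of the derivative at the point's own coordinate; moving the
  base point to \<open>u(i := z)\<close> reaches every \<open>z\<close>.\<close>

lemma C1_partial:
  assumes "C1 r f" "i \<le> r" "u \<in> extensional {..r}"
  shows "((\<lambda>s. f (u(i := s))) has_real_derivative deriv (\<lambda>s. f (u(i := s))) z) (at z)"
proof -
  have "u(i := z) \<in> extensional {..r}" using assms by (auto simp: extensional_def)
  then have "(\<lambda>s. f ((u(i := z))(i := s))) field_differentiable (at ((u(i := z)) i))"
    using assms(1,2) unfolding C1_def by blast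
  then show ?thesis by (simp add: DERIV_deriv_iff_field_differentiable)
qed

lemma C1_partial_tendsto:
  assumes "C1 r f" "i \<le> r" and u: "u \<in> extensional {..r}"
    and w: "\<And>n. w n \<in> extensional {..r}"
    and lim: "\<And>k. k \<le> r \<Longrightarrow> ((\<lambda>n. w n k) \<longlongrightarrow> u k) F"
  shows "((\<lambda>n. deriv (\<lambda>s. f ((w n)(i := s))) (w n i)) \<longlongrightarrow> deriv (\<lambda>s. f (u(i := s))) (u i)) F"
proof -
  have "continuous_on (extensional {..r}) (\<lambda>u. deriv (\<lambda>s. f (u(i := s))) (u i))"
    using assms by (auto simp: C1_def)
  moreover have "(w \<longlongrightarrow> u) F"
  proof (rule tendsto_coordinatewise)
    fix k show "((\<lambda>n. w n k) \<longlongrightarrow> u k) F"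
      \<comment> \<open>Beyond index \<open>r\<close> all extensional points share one default
        value, so those coordinates are constant.\<close>
      using lim[of k] u w by (cases "k \<le> r") (auto simp: extensional_def)
  qed
  ultimately show ?thesis
    by (rule continuous_on_tendsto_compose) (use u w in auto)
qed

text \<open>Move from \<open>u\<close> to \<open>u + h * v\<close> one coordinate at a time, apply
  the mean value theorem to each move, and let \<open>h\<close> tend to 0, using continuity of the
  partial derivatives.\<close>

lemma C1_chain_0:
  fixes u v :: "nat \<Rightarrow> real"
  assumes f: "C1 r f"
  defines "w \<equiv> (\<lambda>i\<in>{..r}. u i)"
  shows "((\<lambda>s. f (\<lambda>i\<in>{..r}. u i + s * v i)) has_real_derivative
           (\<Sum>i\<le>r. deriv (\<lambda>\<sigma>. f (w(i := \<sigma>))) (w i) * v i)) (at 0)"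
proof -
  \<comment> \<open>In \<open>W h i\<close> the coordinates below \<open>i\<close> have already been
    moved; hence \<open>W h 0 = w\<close>, and \<open>W h (Suc r)\<close> is the displaced
    point.\<close>
  define W where "W h i = (\<lambda>k\<in>{..r}. u k + (if k < i then h * v k else 0))" for h i
  define G where "G i w = deriv (\<lambda>\<sigma>. f (w(i := \<sigma>))) (w i)" for i w
  have ext: "W h i \<in> extensional {..r}" for h i
    by (simp add: W_def)
  have "\<exists>\<xi>. i \<le> r \<longrightarrow> \<bar>\<xi> - u i\<bar> \<le> \<bar>h * v i\<bar> \<and>
          f (W h (Suc i)) - f (W h i) = h * v i * G i ((W h i)(i := \<xi>))" for h i
  proof (cases "i \<le> r")
    case True
    then have "(W h i)(i := u i) = W h i" "(W h i)(i := u i + h * v i) = W h (Suc i)"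
      by (auto simp: W_def)
    with MVT_unordered[OF C1_partial[OF f True ext], of "u i" "u i + h * v i" h i]
    show ?thesis by (simp add: G_def)
  qed simp
  then have "\<exists>\<xi>. \<forall>h i. i \<le> r \<longrightarrow> \<bar>\<xi> h i - u i\<bar> \<le> \<bar>h * v i\<bar> \<and>
          f (W h (Suc i)) - f (W h i) = h * v i * G i ((W h i)(i := \<xi> h i))"
    by (intro choice allI)
  then obtain \<xi> where \<xi>: "\<And>h i. i \<le> r \<Longrightarrow> \<bar>\<xi> h i - u i\<bar> \<le> \<bar>h * v i\<bar>"
    and diff: "\<And>h i. i \<le> r \<Longrightarrow>
          f (W h (Suc i)) - f (W h i) = h * v i * G i ((W h i)(i := \<xi> h i))"
    by blast
  \<comment> \<open>The intermediate points tend to \<open>w\<close> in every coordinate, as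
    \<open>\<xi> h i\<close> stays within \<open>\<bar>h * v i\<bar>\<close> of
    \<open>u i\<close>.\<close>
  have "((\<lambda>h. G i ((W h i)(i := \<xi> h i))) \<longlongrightarrow> G i w) (at 0)" if i: "i \<le> r" for i
    unfolding G_def
  proof (rule C1_partial_tendsto[OF f i])
    show "w \<in> extensional {..r}" by (simp add: w_def)
    show "(W h i)(i := \<xi> h i) \<in> extensional {..r}" for h
      using ext[of h i] i by (auto simp: extensional_def)
    fix k assume k: "k \<le> r"
    show "((\<lambda>h. ((W h i)(i := \<xi> h i)) k) \<longlongrightarrow> w k) (at 0)"
    proof (cases "k = i")
      case True
      have "((\<lambda>h. \<bar>h * v i\<bar>) \<longlongrightarrow> 0) (at 0)" by (auto intro!: tendsto_eq_intros)
      then have "((\<lambda>h. \<xi> h i - u i) \<longlongrightarrow> 0) (at 0)"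
        by (rule Lim_null_comparison[rotated]) (use \<xi> i in auto)
      then show ?thesis using True i by (simp add: w_def LIM_zero_iff)
    next
      case False
      have "((\<lambda>h. u k + (if k < i then h * v k else 0)) \<longlongrightarrow> u k) (at 0)"
        by (cases "k < i") (auto intro!: tendsto_eq_intros)
      then show ?thesis using False k by (simp add: w_def W_def)
    qed
  qed
  then have lim: "((\<lambda>h. \<Sum>i\<le>r. G i ((W h i)(i := \<xi> h i)) * v i) \<longlongrightarrow> (\<Sum>i\<le>r. G i w * v i)) (at 0)"
    by (intro tendsto_intros) auto
  have eq: "(\<Sum>i\<le>r. G i ((W h i)(i := \<xi> h i)) * v i) = (f (\<lambda>i\<in>{..r}. u i + h * v i) - f w) / h"
    if "h \<noteq> 0" for h
  proof -
    have "f (W h (Suc r)) - f (W h 0) = (\<Sum>i\<le>r. f (W h (Suc i)) - f (W h i))"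
      using sum_lessThan_telescope[of "\<lambda>i. f (W h i)" "Suc r"] by (simp only: lessThan_Suc_atMost)
    also have "\<dots> = h * (\<Sum>i\<le>r. G i ((W h i)(i := \<xi> h i)) * v i)"
      by (simp add: diff sum_distrib_left mult_ac)
    also have "W h (Suc r) = (\<lambda>i\<in>{..r}. u i + h * v i)" by (auto simp: W_def)
    also have "W h 0 = w" by (auto simp: W_def w_def)
    finally show ?thesis using that by (simp del: fun_upd_apply restrict_apply)
  qed
  have "\<forall>\<^sub>F h in at 0. (\<Sum>i\<le>r. G i ((W h i)(i := \<xi> h i)) * v i) = (f (\<lambda>i\<in>{..r}. u i + h * v i) - f w) / h"
    using eq by (simp add: eventually_at_filter)
  with lim have "((\<lambda>h. (f (\<lambda>i\<in>{..r}. u i + h * v i) - f w) / h) \<longlongrightarrow> (\<Sum>i\<le>r. G i w * v i)) (at 0)"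
    by (rule Lim_transform_eventually)
  then show ?thesis by (simp add: DERIV_def G_def w_def[symmetric])
qed

lemma C1_chain:
  fixes u v :: "nat \<Rightarrow> real"
  assumes f: "C1 r f"
  defines "w \<equiv> \<lambda>s. (\<lambda>i\<in>{..r}. u i + s * v i)"
  shows "((\<lambda>s. f (w s)) has_real_derivative
           (\<Sum>i\<le>r. deriv (\<lambda>\<sigma>. f ((w s)(i := \<sigma>))) (w s i) * v i)) (at s)"
proof -
  have "((\<lambda>h. f (w (h + s))) has_real_derivative
           (\<Sum>i\<le>r. deriv (\<lambda>\<sigma>. f ((w s)(i := \<sigma>))) (w s i) * v i)) (at 0)"
    using C1_chain_0[OF f, of "\<lambda>i. u i + s * v i" v] by (simp add: w_def algebra_simps)
  then show ?thesis using DERIV_shift[of "\<lambda>s. f (w s)" _ 0 s] by simp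
qed

section \<open>The first variation\<close>

lemma continuous_integral_zero_imp_zero:
  fixes f :: "real \<Rightarrow> real"
  assumes f: "continuous_on {a..} f" and zero: "\<And>b. b > a \<Longrightarrow> integral {a..b} f = 0" and t: "t > a"
  shows "f t = 0"
proof -
  have "continuous_on {a..t + 1} f" using f by (rule continuous_on_subset) auto
  then have "((\<lambda>u. integral {a..u} f) has_real_derivative f t) (at t within {a..t + 1})"
    using t by (intro integral_has_real_derivative) auto
  moreover have "at t within {a..t + 1} = at t"
    using t by (intro at_within_interior) auto
  ultimately have "((\<lambda>u. integral {a..u} f) has_real_derivative f t) (at t)" by simp
  moreover have "((\<lambda>u. integral {a..u} f) has_real_derivative 0) (at t)"
    by (rule has_field_derivative_transform_within_open[of "\<lambda>_. 0" _ _ "{a<..}"]) (use zero t in auto)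
  ultimately show ?thesis by (rule DERIV_unique)
qed

lemma perturbed_jet_eq_jet:
  assumes "x \<in> Ck r a" "\<eta> \<in> Ck r a" "t \<ge> a"
  shows "perturbed_jet r a x \<eta> s t = jet r a (\<lambda>t. x t + s * \<eta> t) t"
  using assms by (auto simp: perturbed_jet_def jet_def nderiv_add_scaled restrict_def)

text \<open>Regularity in \<open>t\<close> is available only along jets of curves in
  \<open>Ck r a\<close>, and regularity in \<open>u\<close> only at fixed \<open>t\<close>; local
  bounds have to be won from these separate properties.\<close>

locale lagrangian =
  fixes r :: nat and a :: real and L :: "real \<Rightarrow> (nat \<Rightarrow> real) \<Rightarrow> real"
  assumes L_C1: "t \<ge> a \<Longrightarrow> C1 r (L t)"
    and L_cont: "i \<le> r \<Longrightarrow> x \<in> Ck r a \<Longrightarrow>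
          continuous_on {a..} (\<lambda>t. argderiv L (i + 2) t (jet r a x t))"
begin

definition dL :: "nat \<Rightarrow> (real \<Rightarrow> real) \<Rightarrow> real \<Rightarrow> real" where
  "dL i x t = argderiv L (i + 2) t (jet r a x t)"

lemma dL_tendsto:
  assumes "t \<ge> a" "i \<le> r"
    and "\<And>k. k \<le> r \<Longrightarrow> ((\<lambda>n. nderiv a k (y n) t) \<longlongrightarrow> nderiv a k x t) F"
  shows "((\<lambda>n. dL i (y n) t) \<longlongrightarrow> dL i x t) F"
  unfolding dL_def argderiv_def add_diff_cancel_right'
  by (rule C1_partial_tendsto[OF L_C1]) (use assms in \<open>auto simp: jet_def\<close>)

text \<open>The radius 1 / N shrinks as the bound N grows, so that continuity in the jet variables alone
  makes every point satisfy this for some N.\<close>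

definition bounded_near :: "(real \<Rightarrow> real) \<Rightarrow> real \<Rightarrow> real \<Rightarrow> bool" where
  "bounded_near x N t \<longleftrightarrow> (\<forall>y\<in>Ck r a. (\<forall>k\<le>r. \<bar>nderiv a k y t - nderiv a k x t\<bar> < 1 / N) \<longrightarrow>
     (\<forall>i\<le>r. \<bar>dL i y t\<bar> \<le> N))"

section \<open>Local bounds by Baire's theorem\<close>

text \<open>The sets \<open>E n\<close> of points that satisfy the bound with constant
  \<open>Suc n\<close> are closed and cover \<open>{p..q}\<close>, so one of them contains an
  interval.\<close>

lemma locally_bounded_interval:
  assumes x: "x \<in> Ck r a" and pq: "a \<le> p" "p < q"
  obtains c d N where "p \<le> c" "c < d" "d \<le> q" "N > 0"
    and "\<And>t. t \<in> {c..d} \<Longrightarrow> bounded_near x N t"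
proof -
  define near where "near n y t \<longleftrightarrow> (\<forall>k\<le>r. \<bar>nderiv a k y t - nderiv a k x t\<bar> < 1 / Suc n)" for n y t
  define E where "E n = {t \<in> {p..q}. bounded_near x (Suc n) t}" for n
  have E_eq: "E n = {t \<in> {p..q}. \<forall>y \<in> Ck r a. near n y t \<longrightarrow> (\<forall>i\<le>r. \<bar>dL i y t\<bar> \<le> Suc n)}" for n
    by (simp add: E_def near_def bounded_near_def)
  have sub: "{p..q} \<subseteq> {a..}" using pq by auto
  have "closed (E n)" for n
  proof -
    \<comment> \<open>The implication from nearness to boundedness becomes a union: at points of
      \<open>Z y i\<close>, either \<open>y\<close> is far from \<open>x\<close> or the bound holds.
      As nearness is strict, both conditions are closed.\<close>
    define Z where "Z y i = (\<Union>k\<le>r. {t \<in> {p..q}. 1 / Suc n \<le> \<bar>nderiv a k y t - nderiv a k x t\<bar>})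
        \<union> {t \<in> {p..q}. \<bar>dL i y t\<bar> \<le> Suc n}" for y i
    have "closed (Z y i)" if "y \<in> Ck r a" "i \<le> r" for y i
      unfolding Z_def dL_def using that x
      by (intro closed_Un closed_UN continuous_on_closed_Collect_le continuous_intros ballI finite_atMost
            continuous_on_subset[OF continuous_on_nderiv sub] continuous_on_subset[OF L_cont sub]) auto
    moreover have "E n = {p..q} \<inter> (\<Inter>y\<in>Ck r a. \<Inter>i\<le>r. Z y i)"
    proof (intro equalityI subsetI)
      fix t assume "t \<in> E n"
      then show "t \<in> {p..q} \<inter> (\<Inter>y\<in>Ck r a. \<Inter>i\<le>r. Z y i)"
        by (auto simp: E_eq Z_def near_def not_le)
    next
      fix t assume t: "t \<in> {p..q} \<inter> (\<Inter>y\<in>Ck r a. \<Inter>i\<le>r. Z y i)"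
      have "\<bar>dL i y t\<bar> \<le> Suc n" if "y \<in> Ck r a" "near n y t" "i \<le> r" for y i
      proof -
        have "t \<in> Z y i" using t that by blast
        with that(2) show ?thesis by (auto simp: Z_def near_def not_less[symmetric])
      qed
      with t show "t \<in> E n" by (auto simp: E_eq)
    qed
    ultimately show ?thesis by (auto intro!: closed_Int closed_INT)
  qed
  then have E: "openin (top_of_set {p..q}) ({p..q} - E n)" for n
    by (metis Diff_eq open_Compl openin_open_Int)
  \<comment> \<open>A point outside all \<open>E n\<close> would give curves whose jets at
    \<open>t\<close> converge to that of \<open>x\<close> while their partial derivatives at
    \<open>t\<close> are unbounded, against continuity in the jet variables.\<close>
  have "\<exists>n. t \<in> E n" if t: "t \<in> {p..q}" for t
  proof (rule ccontr)
    assume "\<not> ?thesis"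
    then have "\<forall>n. \<exists>y\<in>Ck r a. near n y t \<and> (\<exists>i\<le>r. \<bar>dL i y t\<bar> > Suc n)"
      using t by (simp add: E_eq not_le)
    then obtain y i where y: "\<And>n. near n (y n) t" "\<And>n. i n \<le> r" "\<And>n. \<bar>dL (i n) (y n) t\<bar> > Suc n"
      by metis
    have "(\<lambda>n. dL j (y n) t) \<longlonglongrightarrow> dL j x t" if "j \<le> r" for j
    proof (rule dL_tendsto[OF _ that])
      fix k assume "k \<le> r"
      then have "norm (nderiv a k (y n) t - nderiv a k x t) \<le> inverse (Suc n)" for n
        using y(1)[of n] by (auto simp: near_def inverse_eq_divide intro: less_imp_le)
      then have "(\<lambda>n. nderiv a k (y n) t - nderiv a k x t) \<longlonglongrightarrow> 0"
        by (intro Lim_null_comparison[OF _ LIMSEQ_inverse_real_of_nat] always_eventually) auto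
      then show "(\<lambda>n. nderiv a k (y n) t) \<longlonglongrightarrow> nderiv a k x t" by (simp add: LIM_zero_iff)
    qed (use t sub in auto)
    \<comment> \<open>The index \<open>i n\<close> may vary with \<open>n\<close>; summing over all
      \<open>j\<close> bounds every partial derivative at once.\<close>
    then have "(\<lambda>n. \<Sum>j\<le>r. \<bar>dL j (y n) t\<bar>) \<longlonglongrightarrow> (\<Sum>j\<le>r. \<bar>dL j x t\<bar>)"
      by (intro tendsto_intros) auto
    then have "Bseq (\<lambda>n. \<Sum>j\<le>r. \<bar>dL j (y n) t\<bar>)" by (intro convergent_imp_Bseq convergentI)
    then obtain K where K: "\<And>n. \<bar>\<Sum>j\<le>r. \<bar>dL j (y n) t\<bar>\<bar> \<le> K" by (auto simp: Bseq_def)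
    obtain n where "K \<le> real n" using real_arch_simple by blast
    moreover have "\<bar>dL (i n) (y n) t\<bar> \<le> (\<Sum>j\<le>r. \<bar>dL j (y n) t\<bar>)"
      using y(2) by (intro member_le_sum) auto
    ultimately show False using K[of n] y(3)[of n] by linarith
  qed
  then have empty: "\<Inter>(range (\<lambda>n. {p..q} - E n)) = {}" by blast
  \<comment> \<open>Baire's theorem in complementary form: countably many relatively open sets with
    empty intersection cannot all be dense in \<open>{p..q}\<close>.\<close>
  have "\<exists>n. \<not> {p..q} \<subseteq> closure ({p..q} - E n)"
  proof (rule ccontr)
    assume "\<not> ?thesis"
    then have "{p..q} \<subseteq> closure (\<Inter>(range (\<lambda>n. {p..q} - E n)))"
      using E by (intro Baire) auto
    then show False using pq unfolding empty by simp
  qed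
  then obtain n t where t: "t \<in> {p..q}" "t \<notin> closure ({p..q} - E n)" by blast
  then obtain e where e: "e > 0" "\<And>s. s \<in> {p..q} - E n \<Longrightarrow> e \<le> dist s t"
    by (auto simp: closure_approachable not_less)
  \<comment> \<open>Points of \<open>{p..q}\<close> at distance less than \<open>e\<close> from
    \<open>t\<close> lie in \<open>E n\<close>; the radius \<open>e / 2\<close> keeps a closed
    interval inside, clipped to \<open>{p..q}\<close>.\<close>
  define c d where "c = max p (t - e / 2)" and "d = min q (t + e / 2)"
  show thesis
  proof (rule that[of c d "real (Suc n)"])
    show "p \<le> c" "c < d" "d \<le> q" "real (Suc n) > 0"
      using t(1) pq e(1) by (auto simp: c_def d_def)
    show "bounded_near x (real (Suc n)) s" if s: "s \<in> {c..d}" for s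
    proof -
      have "s \<in> E n"
      proof (rule ccontr)
        assume "s \<notin> E n"
        then have "e \<le> dist s t" using s e(2)[of s] by (auto simp: c_def d_def)
        then show False using s e(1) by (auto simp: c_def d_def dist_real_def)
      qed
      then show ?thesis by (simp add: E_def)
    qed
  qed
qed

section \<open>Difference quotients and the limit of \<open>A\<close>\<close>

text \<open>At \<open>s = 0\<close> this is the integrand of the first variation; other values of
  \<open>s\<close> enter through the difference quotients.\<close>

definition dirderiv :: "(real \<Rightarrow> real) \<Rightarrow> (real \<Rightarrow> real) \<Rightarrow> real \<Rightarrow> real \<Rightarrow> real" where
  "dirderiv x \<eta> s t = (\<Sum>i\<le>r. dL i (\<lambda>t. x t + s * \<eta> t) t * nderiv a i \<eta> t)"

context
  fixes x \<eta> :: "real \<Rightarrow> real"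
  assumes x: "x \<in> Ck r a" and \<eta>: "\<eta> \<in> Ck r a"
begin

lemma L_perturbed_deriv:
  assumes t: "t \<ge> a"
  shows "((\<lambda>s. L t (perturbed_jet r a x \<eta> s t)) has_real_derivative dirderiv x \<eta> s t) (at s)"
  unfolding dirderiv_def dL_def argderiv_def add_diff_cancel_right'
    perturbed_jet_eq_jet[OF x \<eta> t, symmetric]
  unfolding perturbed_jet_def by (rule C1_chain[OF L_C1[OF t]])

lemma continuous_dirderiv_curve: "continuous_on {a..} (dirderiv x \<eta> s)"
  unfolding dirderiv_def dL_def
  by (intro continuous_intros L_cont continuous_on_nderiv[OF \<eta>] Ck_add_scaled x \<eta>) auto

lemma continuous_dirderiv_parameter:
  assumes t: "t \<ge> a"
  shows "continuous_on S (\<lambda>s. dirderiv x \<eta> s t)"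
proof -
  have "((\<lambda>s. dirderiv x \<eta> s t) \<longlongrightarrow> dirderiv x \<eta> s0 t) (at s0 within S)" for s0
    unfolding dirderiv_def using t x \<eta>
    by (intro tendsto_intros dL_tendsto) (auto simp: nderiv_add_scaled intro!: tendsto_intros)
  then show ?thesis by (simp add: continuous_on_def)
qed

text \<open>Transfers bounds and continuity from the partial derivatives to the quotient, as no
  regularity of \<open>L\<close> itself in \<open>t\<close> is assumed.\<close>

lemma difference_quotient_eq_integral:
  assumes t: "t \<ge> a" and s: "s \<noteq> 0"
  shows "(L t (perturbed_jet r a x \<eta> s t) - L t (jet r a x t)) / s
           = integral {0..1} (\<lambda>\<sigma>. dirderiv x \<eta> (s * \<sigma>) t)"
proof -
  \<comment> \<open>Scaling the parameter to \<open>\<sigma>\<close> in \<open>{0..1}\<close> treats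
    both signs of \<open>s\<close> at once.\<close>
  have "((\<lambda>\<sigma>. L t (perturbed_jet r a x \<eta> (s * \<sigma>) t) / s) has_vector_derivative dirderiv x \<eta> (s * \<sigma>) t)
          (at \<sigma> within {0..1})" for \<sigma>
  proof -
    have "((\<lambda>\<sigma>. L t (perturbed_jet r a x \<eta> (s * \<sigma>) t)) has_real_derivative dirderiv x \<eta> (s * \<sigma>) t * s) (at \<sigma>)"
      by (rule DERIV_chain'[OF _ L_perturbed_deriv[OF t]]) (auto intro!: derivative_eq_intros)
    from DERIV_cdivide[OF this, of s] s show ?thesis
      by (simp add: has_real_derivative_iff_has_vector_derivative has_vector_derivative_at_within)
  qed
  from fundamental_theorem_of_calculus[OF _ this]
  have "((\<lambda>\<sigma>. dirderiv x \<eta> (s * \<sigma>) t) has_integral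
      (L t (perturbed_jet r a x \<eta> s t) / s - L t (perturbed_jet r a x \<eta> 0 t) / s)) {0..1}"
    by simp
  moreover have "perturbed_jet r a x \<eta> 0 t = jet r a x t"
    by (simp add: perturbed_jet_def jet_def)
  ultimately show ?thesis by (simp add: integral_unique diff_divide_distrib)
qed

text \<open>Dominated convergence is used twice, with the constant \<open>M\<close>: over
  \<open>\<sigma>\<close> it makes the quotient continuous in \<open>t\<close>, hence integrable;
  over \<open>t\<close> it carries the limit under the integral.\<close>

lemma A_tendsto:
  assumes s0: "s0 > 0"
    and bound: "\<And>s t. \<bar>s\<bar> \<le> s0 \<Longrightarrow> t \<in> {a..b} \<Longrightarrow> \<bar>dirderiv x \<eta> s t\<bar> \<le> M"
  shows "((\<lambda>s. A L r a x \<eta> s b) \<longlongrightarrow> integral {a..b} (dirderiv x \<eta> 0)) (at 0)"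
proof -
  define Q where "Q s t = (L t (perturbed_jet r a x \<eta> s t) - L t (jet r a x t)) / s" for s t
  have Q_eq: "Q s t = integral {0..1} (\<lambda>\<sigma>. dirderiv x \<eta> (s * \<sigma>) t)" if "t \<ge> a" "s \<noteq> 0" for s t
    using that by (simp add: Q_def difference_quotient_eq_integral)
  have Q_lim: "((\<lambda>s. Q s t) \<longlongrightarrow> dirderiv x \<eta> 0 t) (at 0)" if "t \<ge> a" for t
  proof -
    have "perturbed_jet r a x \<eta> 0 t = jet r a x t"
      by (simp add: perturbed_jet_def jet_def)
    then show ?thesis using L_perturbed_deriv[OF that, of 0] by (simp add: DERIV_def Q_def)
  qed
  have int_dir: "(\<lambda>\<sigma>. dirderiv x \<eta> (s * \<sigma>) t) integrable_on {0..1}" if "t \<ge> a" for s t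
    using continuous_dirderiv_parameter[OF that, of UNIV]
    by (intro integrable_continuous_real) (auto intro!: continuous_on_compose2[of UNIV "\<lambda>s. dirderiv x \<eta> s t"] continuous_intros)
  have scaled: "\<bar>s * \<sigma>\<bar> \<le> s0" if "\<bar>s\<bar> \<le> s0" "\<sigma> \<in> {0..1}" for s \<sigma>
    using that mult_mono[of "\<bar>s\<bar>" s0 "\<bar>\<sigma>\<bar>" 1] by (auto simp: abs_mult)
  have Q_bound: "\<bar>Q s t\<bar> \<le> M" if s: "\<bar>s\<bar> \<le> s0" "s \<noteq> 0" and t: "t \<in> {a..b}" for s t
  proof -
    have "norm (integral {0..1} (\<lambda>\<sigma>. dirderiv x \<eta> (s * \<sigma>) t)) \<le> integral {0..1::real} (\<lambda>_. M)"
      using t bound[OF scaled[OF s(1)] t] by (intro integral_norm_bound_integral int_dir) auto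
    then show ?thesis using s t by (simp add: Q_eq)
  qed
  have Q_int: "Q s integrable_on {a..b}" if s: "\<bar>s\<bar> \<le> s0" "s \<noteq> 0" for s
  proof (rule integrable_continuous_real)
    have "(\<lambda>n. integral {0..1} (\<lambda>\<sigma>. dirderiv x \<eta> (s * \<sigma>) (\<tau> n)))
            \<longlonglongrightarrow> integral {0..1} (\<lambda>\<sigma>. dirderiv x \<eta> (s * \<sigma>) t)"
      if \<tau>: "\<And>n. \<tau> n \<in> {a..b}" "t \<in> {a..b}" "\<tau> \<longlonglongrightarrow> t" for \<tau> t
    proof (rule dominated_convergence(2)[where h = "\<lambda>_. M"])
      show "(\<lambda>\<sigma>. dirderiv x \<eta> (s * \<sigma>) (\<tau> n)) integrable_on {0..1}" for n
        using \<tau>(1)[of n] by (intro int_dir) auto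
      show "norm (dirderiv x \<eta> (s * \<sigma>) (\<tau> n)) \<le> M" if "\<sigma> \<in> {0..1}" for n \<sigma>
        using bound[OF scaled[OF s(1) that] \<tau>(1)] by simp
      show "(\<lambda>n. dirderiv x \<eta> (s * \<sigma>) (\<tau> n)) \<longlonglongrightarrow> dirderiv x \<eta> (s * \<sigma>) t" for \<sigma>
        using \<tau> by (intro continuous_on_tendsto_compose[OF continuous_dirderiv_curve]) auto
    qed auto
    then have "continuous_on {a..b} (\<lambda>t. integral {0..1} (\<lambda>\<sigma>. dirderiv x \<eta> (s * \<sigma>) t))"
      by (auto simp: continuous_on_sequentially o_def)
    then show "continuous_on {a..b} (Q s)"
      using s by (rule_tac continuous_on_eq) (auto simp: Q_eq)
  qed
  have "(\<lambda>n. integral {a..b} (Q (s n))) \<longlonglongrightarrow> integral {a..b} (dirderiv x \<eta> 0)"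
    if s: "\<And>n. s n \<noteq> 0" "s \<longlonglongrightarrow> 0" for s
  proof -
    have "\<forall>\<^sub>F n in sequentially. \<bar>s n\<bar> < s0"
      using order_tendstoD(2)[OF tendsto_rabs_zero[OF s(2)] s0] .
    then obtain N where N: "\<And>n. n \<ge> N \<Longrightarrow> \<bar>s n\<bar> \<le> s0"
      by (auto simp: eventually_sequentially intro: less_imp_le)
    have "(\<lambda>n. integral {a..b} (Q (s (n + N)))) \<longlonglongrightarrow> integral {a..b} (dirderiv x \<eta> 0)"
    proof (rule dominated_convergence(2)[where h = "\<lambda>_. M"])
      show "(\<lambda>n. Q (s (n + N)) t) \<longlonglongrightarrow> dirderiv x \<eta> 0 t" if "t \<in> {a..b}" for t
      proof (rule filterlim_compose[OF Q_lim])
        show "filterlim (\<lambda>n. s (n + N)) (at 0) sequentially"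
          using s LIMSEQ_ignore_initial_segment[OF s(2)] by (auto simp: filterlim_at)
      qed (use that in auto)
    qed (use N s Q_int Q_bound in auto)
    then show ?thesis by (rule LIMSEQ_offset)
  qed
  then have "((\<lambda>s. integral {a..b} (Q s)) \<longlongrightarrow> integral {a..b} (dirderiv x \<eta> 0)) (at 0)"
    by (auto simp: tendsto_at_iff_sequentially o_def)
  then show ?thesis by (simp add: A_def[abs_def] Q_def[abs_def])
qed

end

text \<open>Outside \<open>{c..d}\<close> every summand is zero; inside, a small \<open>s\<close>
  keeps the perturbed jet where \<open>bounded_near\<close> bounds the partial derivatives.\<close>

lemma dirderiv_bound:
  assumes x: "x \<in> Ck r a" and \<eta>: "\<eta> \<in> Ck r a" and c: "a \<le> c"
    and supp: "\<And>i t. i \<le> r \<Longrightarrow> t \<ge> a \<Longrightarrow> t \<notin> {c..d} \<Longrightarrow> nderiv a i \<eta> t = 0"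
    and N: "N > 0" "\<And>t. t \<in> {c..d} \<Longrightarrow> bounded_near x N t"
  shows "\<exists>s0>0. \<exists>M. \<forall>s t. \<bar>s\<bar> \<le> s0 \<longrightarrow> t \<ge> a \<longrightarrow> \<bar>dirderiv x \<eta> s t\<bar> \<le> M"
proof -
  have "\<exists>B. \<forall>t\<in>{c..d}. \<bar>nderiv a k \<eta> t\<bar> \<le> B" if "k \<le> r" for k
  proof -
    have "continuous_on {c..d} (nderiv a k \<eta>)"
      using c by (intro continuous_on_subset[OF continuous_on_nderiv[OF \<eta> that]]) auto
    then have "bounded (nderiv a k \<eta> ` {c..d})"
      by (intro compact_imp_bounded compact_continuous_image) auto
    then show ?thesis by (auto simp: bounded_iff)
  qed
  then have "\<exists>B. \<forall>k\<in>{..r}. \<forall>t\<in>{c..d}. \<bar>nderiv a k \<eta> t\<bar> \<le> B k"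
    by (intro bchoice) simp
  then obtain B where "\<forall>k\<in>{..r}. \<forall>t\<in>{c..d}. \<bar>nderiv a k \<eta> t\<bar> \<le> B k" ..
  then have B: "\<bar>nderiv a k \<eta> t\<bar> \<le> B k" if "k \<le> r" "t \<in> {c..d}" for k t
    using that by blast
  define C where "C = (\<Sum>k\<le>r. \<bar>B k\<bar>)"
  have C: "\<bar>nderiv a k \<eta> t\<bar> \<le> C" if "k \<le> r" "t \<in> {c..d}" for k t
  proof -
    have "\<bar>B k\<bar> \<le> C" unfolding C_def using that by (intro member_le_sum) auto
    with B[OF that] show ?thesis by linarith
  qed
  have C0: "C \<ge> 0" by (simp add: C_def sum_nonneg)
  \<comment> \<open>Chosen so that \<open>s0 * C < 1 / N\<close>; the extra 1 makes the inequality
    strict and admits \<open>C = 0\<close>.\<close>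
  define s0 where "s0 = 1 / (N * (C + 1))"
  have s0: "s0 > 0" using N(1) C0 by (simp add: s0_def)
  have "\<bar>dirderiv x \<eta> s t\<bar> \<le> (\<Sum>i\<le>r. N * C)" if s: "\<bar>s\<bar> \<le> s0" and t: "t \<ge> a" for s t
  proof (cases "t \<in> {c..d}")
    case True
    let ?y = "\<lambda>t. x t + s * \<eta> t"
    have "\<bar>nderiv a k ?y t - nderiv a k x t\<bar> < 1 / N" if "k \<le> r" for k
    proof -
      have "\<bar>s * nderiv a k \<eta> t\<bar> \<le> s0 * C"
        unfolding abs_mult using s s0 by (intro mult_mono C[OF that True]) auto
      also have "\<dots> < s0 * (C + 1)" using s0 by simp
      also have "\<dots> = 1 / N" using C0 by (simp add: s0_def)
      finally show ?thesis using nderiv_add_scaled[OF x \<eta> that t, of s] by simp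
    qed
    then have dL: "\<bar>dL i ?y t\<bar> \<le> N" if "i \<le> r" for i
      using N(2)[OF True] Ck_add_scaled[OF x \<eta>, of s] that unfolding bounded_near_def by blast
    have "\<bar>dL i ?y t * nderiv a i \<eta> t\<bar> \<le> N * C" if "i \<le> r" for i
      unfolding abs_mult using N(1) by (intro mult_mono dL[OF that] C[OF that True]) auto
    then show ?thesis
      unfolding dirderiv_def by (intro order_trans[OF sum_abs] sum_mono) auto
  next
    case False
    then have "dirderiv x \<eta> s t = 0"
      unfolding dirderiv_def using supp t by (intro sum.neutral) auto
    then show ?thesis using N(1) C0 by simp
  qed
  with s0 show ?thesis by (intro exI[of _ s0] exI[of _ "\<Sum>i\<le>r. N * C"]) auto
qed

section \<open>Vanishing of the partial derivatives\<close>

text \<open>\<open>stationary\<close> presupposes that \<open>A\<close> has a limit; bumps are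
  therefore placed in intervals where \<open>dirderiv_bound\<close> and \<open>A_tendsto\<close>
  secure one.\<close>

lemma dL_eq_0:
  assumes x: "x \<in> Ck r a"
    and stationary: "\<And>\<eta> b l. admissible r a (\<lambda>_. 0) \<eta> \<Longrightarrow> b > a \<Longrightarrow>
          ((\<lambda>s. A L r a x \<eta> s b) \<longlongrightarrow> l) (at 0) \<Longrightarrow> l = 0"
    and "i \<le> r" "t \<ge> a"
  shows "dL i x t = 0"
proof -
  \<comment> \<open>Common zeros are dense. Taking \<open>a < p\<close> makes the bumps vanish near
    \<open>a\<close>, so they have zero initial data.\<close>
  have zero: "\<exists>t0\<in>{p..q}. \<forall>i\<le>r. dL i x t0 = 0" if pq: "a < p" "p < q" for p q
  proof -
    obtain c d N where cd: "p \<le> c" "c < d" "d \<le> q" "N > 0"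
      and N: "\<And>t. t \<in> {c..d} \<Longrightarrow> bounded_near x N t"
      using locally_bounded_interval[OF x less_imp_le[OF pq(1)] pq(2)] by blast
    define t0 where "t0 = (c + d) / 2"
    have t0: "c < t0" "t0 < d" using cd by (auto simp: t0_def)
    have "dL j x t0 = 0" if "j \<le> r" for j
      using that
    \<comment> \<open>Descending induction from \<open>j = r\<close>: terms with index above
      \<open>j\<close> vanish by the induction hypothesis, those below by the order of the bump at
      \<open>t0\<close>.\<close>
    proof (induction "r - j" arbitrary: j rule: less_induct)
      case less
      \<comment> \<open>The first factor gives order exactly \<open>j\<close> at \<open>t0\<close>;
        the others give order \<open>Suc r\<close> at \<open>c\<close> and \<open>d\<close>, as a
        bump in \<open>Ck r a\<close> requires.\<close>
      define P where "P = [:-t0, 1:] ^ j * ([:-c, 1:] ^ Suc r * [:-d, 1:] ^ Suc r)"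
      define \<eta> where "\<eta> = (\<lambda>t. if t \<in> {c..d} then poly P t else 0)"
      have P: "P \<noteq> 0" by (simp add: P_def del: power_Suc mult_pCons_left mult_pCons_right)
      have order_linear: "order u ([:-v, 1:] ^ n) = 0" if "u \<noteq> v" for u v :: real and n
        using that by (intro order_0I) auto
      have ord: "order t0 P = j" "order c P \<ge> Suc r" "order d P \<ge> Suc r"
        using P t0 cd unfolding P_def
        by (auto simp: order_mult order_power_n_n order_linear simp del: power_Suc mult_pCons_left mult_pCons_right)
      have ac: "a < c" using cd pq by simp
      note bump = Ck_poly_bump[OF ac cd(2) P, of r, folded \<eta>_def] nderiv_poly_bump[OF ac cd(2) P, of r, folded \<eta>_def]
      have \<eta>: "\<eta> \<in> Ck r a" using bump(1) ord by simp
      have nderiv_\<eta>: "nderiv a i \<eta> t = (if t \<in> {c..d} then poly ((pderiv ^^ i) P) t else 0)"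
        if "i \<le> r" "t \<ge> a" for i t
        using bump(2) ord that by simp
      have adm: "admissible r a (\<lambda>_. 0) \<eta>"
        using \<eta> ac by (simp add: admissible_def nderiv_\<eta>)
      have "nderiv a i \<eta> t = 0" if "i \<le> r" "t \<ge> a" "t \<notin> {c..d}" for i t
        using that by (simp only: nderiv_\<eta> if_False)
      from dirderiv_bound[OF x \<eta> less_imp_le[OF ac] this cd(4) N]
      obtain s0 M where "s0 > 0" and M: "\<And>s t. \<bar>s\<bar> \<le> s0 \<Longrightarrow> t \<ge> a \<Longrightarrow> \<bar>dirderiv x \<eta> s t\<bar> \<le> M"
        by blast
      then have "((\<lambda>s. A L r a x \<eta> s b) \<longlongrightarrow> integral {a..b} (dirderiv x \<eta> 0)) (at 0)" for b
        by (intro A_tendsto[OF x \<eta>, where M = M]) auto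
      then have "integral {a..b} (dirderiv x \<eta> 0) = 0" if "b > a" for b
        using stationary[OF adm that] by blast
      then have "dirderiv x \<eta> 0 t0 = 0"
        using ac t0 by (intro continuous_integral_zero_imp_zero[OF continuous_dirderiv_curve[OF x \<eta>]]) auto
      then have "0 = (\<Sum>i\<le>r. dL i x t0 * poly ((pderiv ^^ i) P) t0)"
        using ac t0 by (simp add: dirderiv_def nderiv_\<eta>)
      also have "\<dots> = (\<Sum>i\<le>r. if i = j then dL j x t0 * poly ((pderiv ^^ j) P) t0 else 0)"
      proof (rule sum.cong)
        fix i assume i: "i \<in> {..r}"
        consider "i < j" | "i = j" | "i > j" by linarith
        then show "dL i x t0 * poly ((pderiv ^^ i) P) t0
            = (if i = j then dL j x t0 * poly ((pderiv ^^ j) P) t0 else 0)"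
        proof cases
          case 1
          then show ?thesis using poly_pderiv_funpow_eq_0_iff[OF P, of i t0] ord by simp
        next
          case 3
          then show ?thesis using less(1)[of i] i by simp
        qed simp
      qed simp
      also have "\<dots> = dL j x t0 * poly ((pderiv ^^ j) P) t0"
        using less.prems by simp
      finally show ?case
        using poly_pderiv_funpow_eq_0_iff[OF P, of j t0] ord by simp
    qed
    then show ?thesis using t0 cd by (intro bexI[of _ t0]) auto
  qed
  \<comment> \<open>Common zeros are picked from intervals shrinking to \<open>t\<close> from the
    right, which lie strictly right of \<open>a\<close> even when \<open>t = a\<close>.\<close>
  define \<tau> where "\<tau> n = (SOME t0. t0 \<in> {t + 1 / Suc n..t + 2 / Suc n} \<and> (\<forall>i\<le>r. dL i x t0 = 0))" for n
  have \<tau>: "\<tau> n \<in> {t + 1 / Suc n..t + 2 / Suc n} \<and> (\<forall>i\<le>r. dL i x (\<tau> n) = 0)" for n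
    unfolding \<tau>_def
  proof (rule someI_ex)
    have "a < t + 1 / Suc n" using \<open>t \<ge> a\<close> by (intro add_le_less_mono[of a t 0, simplified]) auto
    moreover have "t + 1 / Suc n < t + 2 / Suc n" by (simp add: divide_strict_right_mono)
    ultimately show "\<exists>t0. t0 \<in> {t + 1 / Suc n..t + 2 / Suc n} \<and> (\<forall>i\<le>r. dL i x t0 = 0)"
      using zero by blast
  qed
  have "\<tau> \<longlonglongrightarrow> t"
  proof (rule real_tendsto_sandwich)
    have *: "(\<lambda>n. t + u / Suc n) \<longlonglongrightarrow> t" for u
      using tendsto_add[OF tendsto_const LIMSEQ_Suc[OF lim_const_over_n[of u]], of t] by simp
    show "(\<lambda>n. t + 1 / Suc n) \<longlonglongrightarrow> t" "(\<lambda>n. t + 2 / Suc n) \<longlonglongrightarrow> t"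
      by (rule *)+
  qed (use \<tau> in auto)
  moreover have "\<tau> n \<in> {a..}" for n
  proof -
    have "t \<le> t + 1 / Suc n" by simp
    moreover have "t + 1 / Suc n \<le> \<tau> n" using \<tau>[of n] by simp
    ultimately show ?thesis using \<open>t \<ge> a\<close> unfolding atLeast_iff by linarith
  qed
  ultimately have "(\<lambda>n. dL i x (\<tau> n)) \<longlonglongrightarrow> dL i x t"
    using \<open>t \<ge> a\<close>
    by (intro continuous_on_tendsto_compose[OF L_cont[OF \<open>i \<le> r\<close> x, folded dL_def]] always_eventually) auto
  moreover have "(\<lambda>n. dL i x (\<tau> n)) = (\<lambda>_. 0)" using \<tau> \<open>i \<le> r\<close> by blast
  ultimately show ?thesis by (simp add: LIMSEQ_const_iff)
qed

end

section \<open>Consequences of maximality\<close>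

text \<open>The perturbed curve is itself admissible, and a later \<open>T\<close> shrinks the set
  over which the infimum runs, so each value is at most the limit.\<close>

lemma V_nonpos:
  assumes max: "weakly_maximal L r a \<alpha> x" and \<eta>: "admissible r a (\<lambda>_. 0) \<eta>"
  shows "V L r a x \<eta> \<epsilon> T \<le> 0"
proof -
  define y where "y = (\<lambda>t. x t + \<epsilon> * \<eta> t)"
  have x: "admissible r a \<alpha> x" using max by (simp add: weakly_maximal_def)
  then have Ck: "x \<in> Ck r a" "\<eta> \<in> Ck r a" using \<eta> by (auto simp: admissible_def)
  have "admissible r a \<alpha> y"
    using x \<eta> by (auto simp: admissible_def y_def Ck_add_scaled nderiv_add_scaled)
  then obtain l where l: "l \<le> 0"
    "((\<lambda>T. INF T'\<in>{T..}. ereal (integral {a..T'} (\<lambda>t. L t (jet r a y t) - L t (jet r a x t)))) \<longlongrightarrow> l) at_top"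
    using max by (auto simp: weakly_maximal_def)
  have "integral {a..b} (\<lambda>t. L t (jet r a y t) - L t (jet r a x t))
      = integral {a..b} (\<lambda>t. L t (perturbed_jet r a x \<eta> \<epsilon> t) - L t (jet r a x t))" for b
    by (rule integral_cong) (simp add: perturbed_jet_eq_jet Ck y_def)
  then have "((\<lambda>T. V L r a x \<eta> \<epsilon> T) \<longlongrightarrow> l) at_top"
    using l(2) by (simp add: V_def)
  moreover have "\<forall>\<^sub>F T' in at_top. V L r a x \<eta> \<epsilon> T \<le> V L r a x \<eta> \<epsilon> T'"
    using eventually_ge_at_top[of T] by eventually_elim (auto simp: V_def intro: INF_superset_mono)
  ultimately have "V L r a x \<eta> \<epsilon> T \<le> l" by (intro tendsto_lowerbound) auto
  with l(1) show ?thesis by simp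
qed

text \<open>Taking \<open>T' = T\<close> in the infimum compares \<open>V\<close> with the integral
  over \<open>{a..T}\<close>; a negative \<open>\<epsilon>\<close> reverses the
  inequalities.\<close>

lemma V_divide_sign:
  assumes max: "weakly_maximal L r a \<alpha> x" and \<eta>: "admissible r a (\<lambda>_. 0) \<eta>"
  shows "\<epsilon> > 0 \<Longrightarrow> V L r a x \<eta> \<epsilon> T / ereal \<epsilon> \<le> 0 \<and> V L r a x \<eta> \<epsilon> T / ereal \<epsilon> \<le> ereal (A L r a x \<eta> \<epsilon> T)"
    and "\<epsilon> < 0 \<Longrightarrow> 0 \<le> V L r a x \<eta> \<epsilon> T / ereal \<epsilon> \<and> ereal (A L r a x \<eta> \<epsilon> T) \<le> V L r a x \<eta> \<epsilon> T / ereal \<epsilon>"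
proof -
  define \<delta> where "\<delta> = integral {a..T} (\<lambda>t. L t (perturbed_jet r a x \<eta> \<epsilon> t) - L t (jet r a x t))"
  have A: "A L r a x \<eta> \<epsilon> T = \<delta> / \<epsilon>" by (simp add: A_def \<delta>_def)
  have le: "V L r a x \<eta> \<epsilon> T \<le> ereal \<delta>" by (auto simp: V_def \<delta>_def intro: INF_lower)
  have nonpos: "V L r a x \<eta> \<epsilon> T \<le> 0" by (rule V_nonpos[OF max \<eta>])
  show "\<epsilon> > 0 \<Longrightarrow> V L r a x \<eta> \<epsilon> T / ereal \<epsilon> \<le> 0 \<and> V L r a x \<eta> \<epsilon> T / ereal \<epsilon> \<le> ereal (A L r a x \<eta> \<epsilon> T)"
    "\<epsilon> < 0 \<Longrightarrow> 0 \<le> V L r a x \<eta> \<epsilon> T / ereal \<epsilon> \<and> ereal (A L r a x \<eta> \<epsilon> T) \<le> V L r a x \<eta> \<epsilon> T / ereal \<epsilon>"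
    \<comment> \<open>The value \<open>-\<infinity>\<close> is possible and becomes either infinity
      according to the sign of \<open>\<epsilon>\<close>; \<open>nonpos\<close> excludes
      \<open>\<infinity>\<close>.\<close>
    using le nonpos
    by (cases "V L r a x \<eta> \<epsilon> T"; simp add: A divide_right_mono divide_right_mono_neg
          divide_nonpos_pos divide_nonpos_neg)+
qed

text \<open>The right-hand limits give \<open>v \<le> 0\<close> and \<open>v \<le> l\<close>, the
  left-hand ones the reverse inequalities.\<close>

lemma A_limit_eq_0:
  assumes max: "weakly_maximal L r a \<alpha> x" and \<eta>: "admissible r a (\<lambda>_. 0) \<eta>"
    and V: "((\<lambda>\<epsilon>. V L r a x \<eta> \<epsilon> T / ereal \<epsilon>) \<longlongrightarrow> ereal v) (at 0)"
    and A: "((\<lambda>\<epsilon>. A L r a x \<eta> \<epsilon> T) \<longlongrightarrow> l) (at 0)"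
  shows "l = 0"
proof -
  note sign = V_divide_sign[OF max \<eta>]
  have pos: "\<forall>\<^sub>F \<epsilon>::real in at_right 0. \<epsilon> > 0" by (simp add: eventually_at_filter)
  have neg: "\<forall>\<^sub>F \<epsilon>::real in at_left 0. \<epsilon> < 0" by (simp add: eventually_at_filter)
  have V': "((\<lambda>\<epsilon>. V L r a x \<eta> \<epsilon> T / ereal \<epsilon>) \<longlongrightarrow> ereal v) (at_right 0)"
    "((\<lambda>\<epsilon>. V L r a x \<eta> \<epsilon> T / ereal \<epsilon>) \<longlongrightarrow> ereal v) (at_left 0)"
    using V by (auto intro: tendsto_mono at_le)
  have A': "((\<lambda>\<epsilon>. ereal (A L r a x \<eta> \<epsilon> T)) \<longlongrightarrow> ereal l) (at_right 0)"
    "((\<lambda>\<epsilon>. ereal (A L r a x \<eta> \<epsilon> T)) \<longlongrightarrow> ereal l) (at_left 0)"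
    using A by (auto intro: tendsto_mono at_le)
  have "ereal v \<le> 0"
    by (rule tendsto_upperbound[OF V'(1)]) (use pos sign in \<open>auto elim: eventually_mono\<close>)
  moreover have "0 \<le> ereal v"
    by (rule tendsto_lowerbound[OF V'(2)]) (use neg sign in \<open>auto elim: eventually_mono\<close>)
  moreover have "ereal v \<le> ereal l"
    by (rule tendsto_le[OF _ A'(1) V'(1)]) (use pos sign in \<open>auto elim: eventually_mono\<close>)
  moreover have "ereal l \<le> ereal v"
    by (rule tendsto_le[OF _ V'(2) A'(2)]) (use neg sign in \<open>auto elim: eventually_mono\<close>)
  ultimately show ?thesis by simp
qed

section \<open>The Euler-Lagrange equation and the transversality conditions\<close>

theorem corollary3p4:
  fixes r :: nat and a :: real and \<alpha> :: "nat \<Rightarrow> real"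
    and L :: "real \<Rightarrow> (nat \<Rightarrow> real) \<Rightarrow> real" and xstar :: "real \<Rightarrow> real"
  assumes L_C1: "\<And>t. t \<ge> a \<Longrightarrow> C1 r (L t)"
    and d2L_C0: "\<And>x. x \<in> Ck r a \<Longrightarrow> continuous_on {a..} (\<lambda>t. argderiv L 2 t (jet r a x t))"
    and dL_Cr: "\<And>i x. i \<in> {1..r} \<Longrightarrow> x \<in> Ck r a \<Longrightarrow>
                   (\<lambda>t. argderiv L (i + 2) t (jet r a x t)) \<in> Ck r a"
    and maximal: "weakly_maximal L r a \<alpha> xstar"
    and hyp1: "\<And>\<eta> T. admissible r a (\<lambda>_. 0) \<eta> \<Longrightarrow> T > a \<Longrightarrow>
                 \<exists>l::real. ((\<lambda>\<epsilon>. V L r a xstar \<eta> \<epsilon> T / ereal \<epsilon>) \<longlongrightarrow> ereal l) (at 0)"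
    and hyp2: "\<And>\<eta>. admissible r a (\<lambda>_. 0) \<eta> \<Longrightarrow>
                 \<exists>W. uniform_limit_ereal (UNIV - {0}) (\<lambda>T \<epsilon>. V L r a xstar \<eta> \<epsilon> T / ereal \<epsilon>) W at_top"
    and hyp3: "\<And>\<eta> T. admissible r a (\<lambda>_. 0) \<eta> \<Longrightarrow> T > a \<Longrightarrow>
                 \<exists>T'::nat \<Rightarrow> real. (\<forall>n. T' n \<ge> T) \<and>
                   uniform_limit_ereal (UNIV - {0}) (\<lambda>n \<epsilon>. ereal (A L r a xstar \<eta> \<epsilon> (T' n)))
                     (\<lambda>\<epsilon>. INF T'\<in>{T..}. ereal (A L r a xstar \<eta> \<epsilon> T')) sequentially"
  shows "(\<forall>t\<ge>a. (\<Sum>i=0..r. (-1) ^ i * nderiv a i (\<lambda>s. argderiv L (i + 2) s (jet r a xstar s)) t) = 0) \<and>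
    (\<forall>k\<in>{1..r}. ((\<lambda>T. INF T'\<in>{T..}. ereal (
        (argderiv L (r + 2 - (k - 1)) T' (jet r a xstar T') +
         (\<Sum>i=1..k-1. (-1) ^ i *
            nderiv a i (\<lambda>s. argderiv L (r + 2 - (k - 1) + i) s (jet r a xstar s)) T'))
        * nderiv a (r - k) xstar T')) \<longlongrightarrow> 0) at_top)"
proof -
  interpret lagrangian r a L
  proof
    fix i x assume i: "i \<le> r" and x: "x \<in> Ck r a"
    show "continuous_on {a..} (\<lambda>t. argderiv L (i + 2) t (jet r a x t))"
    \<comment> \<open>Index 0 is covered by \<open>d2L_C0\<close>; for the others, membership in
      \<open>Ck r a\<close> includes continuity.\<close>
    proof (cases "i = 0")
      case False
      then show ?thesis using continuous_on_nderiv[OF dL_Cr[of i x], of 0] i x by simp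
    qed (use d2L_C0[OF x] in \<open>simp add: numeral_2_eq_2\<close>)
  qed (rule L_C1)
  have "xstar \<in> Ck r a" using maximal by (simp add: weakly_maximal_def admissible_def)
  then have "dL i xstar t = 0" if "i \<le> r" "t \<ge> a" for i t
  proof (rule dL_eq_0)
    fix \<eta> b l assume "admissible r a (\<lambda>_. 0) \<eta>" "b > a" "((\<lambda>s. A L r a xstar \<eta> s b) \<longlongrightarrow> l) (at 0)"
    then show "l = 0" using A_limit_eq_0[OF maximal] hyp1 by blast
  qed (use that in auto)
  then have zero: "argderiv L j t (jet r a xstar t) = 0" if "j \<in> {2..r + 2}" "t \<ge> a" for j t
    using that by (force simp: dL_def dest: le_Suc_ex)
  have nderiv0: "nderiv a i (\<lambda>s. argderiv L j s (jet r a xstar s)) t = 0"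
    if "j \<in> {2..r + 2}" "t \<ge> a" for i j t
    using that zero by (intro nderiv_zero) auto
  have "((\<lambda>T. INF T'\<in>{T..}. ereal (
        (argderiv L (r + 2 - (k - 1)) T' (jet r a xstar T') +
         (\<Sum>i=1..k-1. (-1) ^ i *
            nderiv a i (\<lambda>s. argderiv L (r + 2 - (k - 1) + i) s (jet r a xstar s)) T'))
        * nderiv a (r - k) xstar T')) \<longlongrightarrow> 0) at_top" (is "(?f \<longlongrightarrow> 0) at_top") if k: "k \<in> {1..r}" for k
  \<comment> \<open>For \<open>T \<ge> a\<close> the expression is zero at every
    \<open>T' \<ge> T\<close>, so the infimum is eventually constant.\<close>
  proof (rule tendsto_eventually)
    show "\<forall>\<^sub>F T in at_top. ?f T = 0"
      using eventually_ge_at_top[of a]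
    proof eventually_elim
      case (elim T)
      have "?f T = (INF T'\<in>{T..}. 0)"
      proof (rule INF_cong)
        fix T' assume "T' \<in> {T..}"
        then have T': "T' \<ge> a" using elim by simp
        \<comment> \<open>With \<open>1 \<le> k \<le> r\<close> and \<open>i \<le> k - 1\<close> the
          argument number \<open>r + 2 - (k - 1) + i\<close> stays in \<open>{2..r + 2}\<close>,
          where \<open>nderiv0\<close> applies.\<close>
        have "(\<Sum>i=1..k-1. (-1) ^ i *
            nderiv a i (\<lambda>s. argderiv L (r + 2 - (k - 1) + i) s (jet r a xstar s)) T') = 0"
          using k T' by (intro sum.neutral ballI) (subst nderiv0, auto)
        moreover have "argderiv L (r + 2 - (k - 1)) T' (jet r a xstar T') = 0"
          using k T' by (intro zero) auto
        ultimately show "ereal ((argderiv L (r + 2 - (k - 1)) T' (jet r a xstar T') +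
         (\<Sum>i=1..k-1. (-1) ^ i *
            nderiv a i (\<lambda>s. argderiv L (r + 2 - (k - 1) + i) s (jet r a xstar s)) T'))
        * nderiv a (r - k) xstar T') = 0" by (simp add: zero_ereal_def)
      qed simp
      then show ?case by simp
    qed
  qed
  moreover have "(\<Sum>i=0..r. (-1) ^ i * nderiv a i (\<lambda>s. argderiv L (i + 2) s (jet r a xstar s)) t) = 0"
    if "t \<ge> a" for t
    using that by (intro sum.neutral ballI) (subst nderiv0, auto)
  ultimately show ?thesis by blast
qed

end
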